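(* Let $p,q>1$ be coprime integers, and let $S(p,q)=\{ap+bq : a,b\in\mathbb{Z}_{\ge 0}\}$. Then $$P_{S(p,q)}(x)=(1-x)\sum_{s\in S(p,q)}x^s=\frac{(x^{pq}-1)(x-1)}{(x^p-1)(x^q-1)}.$$
   Context: A numerical semigroup is a set of the form $S=\{x_1a_1+\cdots+x_ma_m : x_i\in\mathbb{Z}_{\ge 0}\}$, with $a_1,\ldots,a_m$ positive integers, whose complement $\mathbb{Z}_{\ge 0}\setminus S$ is finite; $S(p,q)$ is numerical when $p,q$ are coprime. The Hilbert series of $S$ is the formal power series $H_S(x)=\sum_{s\in S}x^s\in\mathbb{Z}[[x]]$, and the semigroup polynomial of $S$ is $P_S(x)=(1-x)H_S(x)$, which is a polynomial. The identity is one of formal power series in $x$. *)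

theory Defs
  imports "HOL-Computational_Algebra.Computational_Algebra"
begin

definition semigroup2 :: "nat \<Rightarrow> nat \<Rightarrow> nat set" where
  "semigroup2 p q = {a * p + b * q | a b. True}"

(* The formal sum of x^s over s in S, i.e. the series whose coefficients are the
   indicator function of S. *)
definition hilbert_series :: "nat set \<Rightarrow> int fps" where
  "hilbert_series S = Abs_fps (\<lambda>n. if n \<in> S then 1 else 0)"

(* The unique polynomial equal, as a power series, to (1 - x) H_S(x). It exists whenever the
   complement of S is finite (lemma fps_of_poly_semigroup_poly); otherwise the value may be
   unspecified. *)
definition semigroup_poly :: "nat set \<Rightarrow> int poly" where
  "semigroup_poly S = (THE P. fps_of_poly P = (1 - fps_X) * hilbert_series S)"

(* The library's division of power series needs an inverse operation on the coefficients, which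
   int lacks. If the constant term of g is a unit of the integers (1 or -1, hence its own
   inverse), g is invertible in Z[[x]] and this is the quotient f/g
   (lemma fps_unit_quotient_unique). *)
definition fps_unit_quotient :: "int fps \<Rightarrow> int fps \<Rightarrow> int fps" where
  "fps_unit_quotient f g = f * fps_right_inverse g (fps_nth g 0)"

lemma fps_unit_quotient_unique:
  assumes "fps_nth g 0 = 1 \<or> fps_nth g 0 = -1"
  shows "h = fps_unit_quotient f g \<longleftrightarrow> h * g = f"
proof -
  have inv: "g * fps_right_inverse g (fps_nth g 0) = 1"
    by (rule fps_right_inverse) (use assms in auto)
  show ?thesis
  proof
    assume "h = fps_unit_quotient f g"
    then have "h * g = f * (g * fps_right_inverse g (fps_nth g 0))"
      by (simp only: fps_unit_quotient_def mult_ac)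
    then show "h * g = f" by (simp only: inv mult_1_right)
  next
    assume "h * g = f"
    then have "fps_unit_quotient f g = h * (g * fps_right_inverse g (fps_nth g 0))"
      by (simp only: fps_unit_quotient_def mult_ac flip: \<open>h * g = f\<close>)
    then show "h = fps_unit_quotient f g" by (simp only: inv mult_1_right)
  qed
qed

lemma fps_of_poly_semigroup_poly:
  assumes "finite (- S)"
  shows "fps_of_poly (semigroup_poly S) = (1 - fps_X) * hilbert_series S"
proof -
  obtain N where N: "\<And>n. n > N \<Longrightarrow> n \<in> S"
    using assms finite_nat_set_iff_bounded_le[of "- S"]
    by (metis ComplI leD)
  define F where "F = (1 - fps_X) * hilbert_series S"
  have z: "fps_nth F n = 0" if "n > Suc N" for n
  proof -
    have "n \<in> S" "n - 1 \<in> S" using N[of n] N[of "n - 1"] that by auto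
    then show ?thesis using that by (simp add: F_def left_diff_distrib hilbert_series_def)
  qed
  have "fps_of_poly (truncate_fps (Suc (Suc N)) F) = F"
    by (rule fps_ext) (use z in \<open>auto simp: coeff_truncate_fps not_less\<close>)
  then have "\<exists>!P. fps_of_poly P = F"
    by (metis fps_of_poly_eq_iff)
  from theI'[OF this] show ?thesis
    by (simp add: semigroup_poly_def F_def)
qed

end

(* The elements n of S(p,q) with n - p not in S(p,q) are exactly the multiples b q with b < p
   (the Apery set of p). Hence (1 - x^p) H(x) is the geometric sum of the x^(b q) with b < p, and
   multiplying by 1 - x^q gives 1 - x^(p q). *)
theory Submission
  imports Defs "HOL-Number_Theory.Cong"
begin

lemma semigroup2_add_left: "n \<in> semigroup2 p q \<Longrightarrow> n + p \<in> semigroup2 p q"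
proof -
  assume "n \<in> semigroup2 p q"
  then obtain a b where "n = a * p + b * q" by (auto simp: semigroup2_def)
  then have "n + p = Suc a * p + b * q" by simp
  then show ?thesis unfolding semigroup2_def by blast
qed

text \<open>Every n \<ge> p q is representable: with x an inverse of q modulo p, the coefficient b =
  x n mod p gives b q congruent to n modulo p and b q \<le> p q \<le> n, so n - b q is a nonnegative
  multiple of p. This is what makes \<open>semigroup_poly\<close> meaningful here.\<close>

lemma finite_compl_semigroup2:
  assumes "p > 0" and "coprime p q"
  shows "finite (- semigroup2 p q)"
proof (rule finite_subset)
  show "- semigroup2 p q \<subseteq> {..<p * q}"
  proof (rule subsetI, rule ccontr)
    fix n assume n: "n \<in> - semigroup2 p q" "n \<notin> {..<p * q}"
    obtain x where "[q * x = 1] (mod p)"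
      using cong_solve_coprime_nat[of q p] assms(2) by (auto simp: coprime_commute)
    from cong_scalar_right[OF this, of n] have "[n = q * (x * n)] (mod p)"
      by (simp add: cong_sym mult.assoc)
    also have "[q * (x * n) = q * (x * n mod p)] (mod p)"
      by (rule cong_scalar_left) simp
    finally have c: "[n = (x * n mod p) * q] (mod p)" by (simp add: mult.commute)
    have "(x * n mod p) * q \<le> n"
    proof (rule order_trans)
      show "(x * n mod p) * q \<le> p * q"
        using assms(1) by (intro mult_le_mono1) simp
      show "p * q \<le> n" using n by simp
    qed
    moreover from this c have "p dvd n - (x * n mod p) * q"
      by (simp add: cong_altdef_nat)
    then obtain a where "n - (x * n mod p) * q = p * a" ..
    ultimately have "n = a * p + (x * n mod p) * q" by (simp add: mult.commute)
    then show False using n(1) by (auto simp: semigroup2_def)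
  qed
qed simp

text \<open>If n = a p + b q with a > 0 or b \<ge> p, a copy of p can be split off without leaving
  the semigroup. Conversely, b q - p = c p + d q would by coprimality force p to divide b - d,
  although 0 < b - d < p.\<close>

lemma semigroup2_apery:
  assumes "p > 0" and "q > 0" and "coprime p q"
  shows "n \<in> semigroup2 p q \<and> \<not> (p \<le> n \<and> n - p \<in> semigroup2 p q)
           \<longleftrightarrow> n \<in> (\<lambda>b. b * q) ` {..<p}"
proof
  assume n: "n \<in> semigroup2 p q \<and> \<not> (p \<le> n \<and> n - p \<in> semigroup2 p q)"
  then obtain a b where ab: "n = a * p + b * q" by (auto simp: semigroup2_def)
  have "a = 0"
  proof (rule ccontr)
    assume "a \<noteq> 0"
    then obtain c where "a = Suc c" by (cases a) auto
    with ab have "p \<le> n" "n - p = c * p + b * q" by simp_all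
    then show False using n unfolding semigroup2_def by blast
  qed
  moreover have "b < p"
  proof (rule ccontr)
    assume "\<not> b < p"
    then obtain d where d: "b = p + d" using le_Suc_ex not_less by blast
    obtain e where e: "q = Suc e" using assms(2) by (cases q) auto
    \<comment> \<open>The block p q is traded for q copies of p; splitting off one leaves e = q - 1
      of them.\<close>
    have "n = p + (e * p + d * q)"
      using ab \<open>a = 0\<close> d by (simp add: e algebra_simps)
    then have "p \<le> n" "n - p = e * p + d * q" by simp_all
    then show False using n unfolding semigroup2_def by blast
  qed
  ultimately show "n \<in> (\<lambda>b. b * q) ` {..<p}" using ab by auto
next
  assume "n \<in> (\<lambda>b. b * q) ` {..<p}"
  then obtain b where b: "n = b * q" "b < p" by auto
  have "n = 0 * p + b * q" using b by simp
  then have "n \<in> semigroup2 p q" unfolding semigroup2_def by blast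
  moreover have False if le: "p \<le> n" and mem: "n - p \<in> semigroup2 p q"
  proof -
    obtain c d where "n - p = c * p + d * q" using mem unfolding semigroup2_def by blast
    with le have n: "b * q = Suc c * p + d * q" using b by simp
    \<comment> \<open>Ensures that the truncated subtraction \<open>b - d\<close> below is a true,
      positive difference.\<close>
    then have "d * q < b * q" using assms(1) by simp
    then have "d < b" by simp
    have "(b - d) * q = Suc c * p" using n by (simp add: diff_mult_distrib)
    then have "p dvd (b - d) * q" by simp
    then have "p dvd b - d" using assms(3) by (simp add: coprime_dvd_mult_left_iff)
    then show False using \<open>d < b\<close> b(2) by (auto dest: dvd_imp_le)
  qed
  ultimately show "n \<in> semigroup2 p q \<and> \<not> (p \<le> n \<and> n - p \<in> semigroup2 p q)" by blast
qed

text \<open>With S the semigroup, the coefficient of x^n on the left is [n in S] -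
  [p \<le> n and n - p in S]. Closure of S under adding p excludes the value -1, which leaves the
  indicator of the Apery set.\<close>

lemma hilbert_series_semigroup2_apery:
  assumes "p > 0" and "q > 0" and "coprime p q"
  shows "(1 - fps_X ^ p) * hilbert_series (semigroup2 p q) = (\<Sum>b<p. (fps_X ^ q) ^ b)"
proof (rule fps_ext)
  fix n
  let ?S = "semigroup2 p q"
  have inj: "inj_on (\<lambda>b. b * q) {..<p}" using assms(2) by (auto simp: inj_on_def)
  have "n - p \<in> ?S \<Longrightarrow> p \<le> n \<Longrightarrow> n \<in> ?S"
    using semigroup2_add_left[of "n - p" p q] by simp
  then have "fps_nth ((1 - fps_X ^ p) * hilbert_series ?S) n =
      (if n \<in> ?S \<and> \<not> (p \<le> n \<and> n - p \<in> ?S) then 1 else 0)"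
    by (auto simp: left_diff_distrib fps_X_power_mult_nth hilbert_series_def)
  also have "\<dots> = (if n \<in> (\<lambda>b. b * q) ` {..<p} then 1 else 0)"
    by (simp only: semigroup2_apery[OF assms])
  \<comment> \<open>Writing the indicator as a sum of deltas allows reindexing along the injective
    map b \<mapsto> b q.\<close>
  also have "\<dots> = (\<Sum>m\<in>(\<lambda>b. b * q) ` {..<p}. if n = m then 1 else 0)"
    by (simp add: sum.delta)
  also have "\<dots> = (\<Sum>b<p. if n = b * q then 1 else 0)"
    by (simp add: sum.reindex[OF inj])
  also have "\<dots> = fps_nth (\<Sum>b<p. (fps_X ^ q) ^ b) n"
    by (simp add: fps_sum_nth fps_X_power_nth mult.commute flip: power_mult)
  finally show "fps_nth ((1 - fps_X ^ p) * hilbert_series ?S) n = fps_nth (\<Sum>b<p. (fps_X ^ q) ^ b) n" .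
qed

theorem theorem1:
  fixes p q :: nat
  assumes "p > 1" and "q > 1" and "coprime p q"
  shows "fps_of_poly (semigroup_poly (semigroup2 p q))
           = (1 - fps_X) * hilbert_series (semigroup2 p q)
       \<and> (1 - fps_X) * hilbert_series (semigroup2 p q)
           = fps_unit_quotient ((fps_X ^ (p * q) - 1) * (fps_X - 1))
                               ((fps_X ^ p - 1) * (fps_X ^ q - 1))"
proof
  have pos: "p > 0" "q > 0" using assms by auto
  let ?H = "hilbert_series (semigroup2 p q)"
  show "fps_of_poly (semigroup_poly (semigroup2 p q)) = (1 - fps_X) * ?H"
    by (intro fps_of_poly_semigroup_poly finite_compl_semigroup2 pos assms)
  \<comment> \<open>The geometric sum has p terms and ratio x^q, so it telescopes.\<close>
  have geometric: "(1 - fps_X ^ q) * ((1 - fps_X ^ p) * ?H) = 1 - fps_X ^ (p * q)"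
    using one_diff_power_eq[of "fps_X ^ q :: int fps" p]
    unfolding hilbert_series_semigroup2_apery[OF pos assms(3)]
    by (simp add: mult.commute[of p] flip: power_mult)
  \<comment> \<open>Signs change in pairs, first in the denominator and then in the numerator, so
    they cancel.\<close>
  have "(1 - fps_X) * ?H * ((fps_X ^ p - 1) * (fps_X ^ q - 1))
      = (1 - fps_X) * ((1 - fps_X ^ q) * ((1 - fps_X ^ p) * ?H))"
    by (simp add: algebra_simps)
  also have "\<dots> = (fps_X ^ (p * q) - 1) * (fps_X - 1)"
    unfolding geometric by (simp add: algebra_simps)
  \<comment> \<open>As p and q are positive, the denominator has constant term (-1)(-1) = 1, so the
    quotient is characterised by the product just computed.\<close>
  finally show "(1 - fps_X) * ?H = fps_unit_quotient ((fps_X ^ (p * q) - 1) * (fps_X - 1))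
      ((fps_X ^ p - 1) * (fps_X ^ q - 1))"
    using pos by (subst fps_unit_quotient_unique) (auto simp: fps_X_power_nth)
qed

end
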